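(* There exists a continuous image of the space $\sigma_2(\omega_1)$ which does not belong to $\mathcal{EC}_2$.
   Context: All topological spaces (in particular, continuous images) are assumed to be Tikhonov (completely regular Hausdorff). For a set $\Gamma$ and $n\in\omega$, $\sigma_n(\Gamma)$ denotes the subspace of the product $2^\Gamma$ (with $2=\{0,1\}$ discrete) consisting of all characteristic functions of subsets of $\Gamma$ of cardinality $\le n$. A compact space $K$ belongs to the class $\mathcal{EC}_n$ if $K$ can be (homeomorphically) embedded in $\sigma_n(\Gamma)$ for some set $\Gamma$. *)

theory Defs
  imports "HOL-Analysis.Analysis"
begin

definition Tikhonov_space :: "'a topology \<Rightarrow> bool"
  where "Tikhonov_space X \<longleftrightarrow> completely_regular_space X \<and> Hausdorff_space X"

(* The cube 2^G is the library product over the index set G, with two-point discrete factor bool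
   (True for 1, False for 0); its points are the functions restricted to G. *)

definition cube :: "'g set \<Rightarrow> ('g \<Rightarrow> bool) topology"
  where "cube \<Gamma> = product_topology (\<lambda>_. discrete_topology (UNIV :: bool set)) \<Gamma>"

definition char_fun :: "'g set \<Rightarrow> 'g set \<Rightarrow> ('g \<Rightarrow> bool)"
  where "char_fun \<Gamma> A = (\<lambda>\<gamma>\<in>\<Gamma>. \<gamma> \<in> A)"

definition sigma_space :: "nat \<Rightarrow> 'g set \<Rightarrow> ('g \<Rightarrow> bool) topology"
  where "sigma_space n \<Gamma> =
    subtopology (cube \<Gamma>) {char_fun \<Gamma> A |A. A \<subseteq> \<Gamma> \<and> finite A \<and> card A \<le> n}"

(* HOL cannot quantify over index sets of all types. The index sets below range over the subsets of
   one type, determined by K, that is large enough: EC_classI shows that an embedding into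
   sigma_space n G for an index set G of any type whatsoever yields membership. *)

definition EC_class :: "nat \<Rightarrow> 'k topology \<Rightarrow> bool"
  where "EC_class n K \<longleftrightarrow> compact_space K \<and>
    (\<exists>(\<Gamma> :: ('k \<times> nat) set) f. embedding_map K (sigma_space n \<Gamma>) f)"

(* The underlying set of the initial ordinal omega_1; only its cardinality matters here. *)

definition omega_1 :: "nat set set"
  where "omega_1 = Field (cardSuc natLeq)"

lemma topspace_sigma_space:
  "topspace (sigma_space n \<Gamma>) =
    {x \<in> extensional \<Gamma>. finite {\<gamma> \<in> \<Gamma>. x \<gamma>} \<and> card {\<gamma> \<in> \<Gamma>. x \<gamma>} \<le> n}"
proof -
  have 1: "{\<gamma> \<in> \<Gamma>. char_fun \<Gamma> A \<gamma>} = A" if "A \<subseteq> \<Gamma>" for A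
    using that by (auto simp: char_fun_def)
  have 2: "x = char_fun \<Gamma> {\<gamma> \<in> \<Gamma>. x \<gamma>}" if "x \<in> extensional \<Gamma>" for x
    using that by (intro ext) (auto simp: char_fun_def extensional_def)
  have 3: "char_fun \<Gamma> A \<in> extensional \<Gamma>" for A
    by (simp add: char_fun_def)
  have "topspace (sigma_space n \<Gamma>) = {char_fun \<Gamma> A |A. A \<subseteq> \<Gamma> \<and> finite A \<and> card A \<le> n}"
    using 3 by (auto simp: sigma_space_def cube_def PiE_def)
  also have "\<dots> = {x \<in> extensional \<Gamma>. finite {\<gamma> \<in> \<Gamma>. x \<gamma>} \<and> card {\<gamma> \<in> \<Gamma>. x \<gamma>} \<le> n}"
  proof (intro equalityI subsetI)
    fix x assume "x \<in> {char_fun \<Gamma> A |A. A \<subseteq> \<Gamma> \<and> finite A \<and> card A \<le> n}"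
    then show "x \<in> {x \<in> extensional \<Gamma>. finite {\<gamma> \<in> \<Gamma>. x \<gamma>} \<and> card {\<gamma> \<in> \<Gamma>. x \<gamma>} \<le> n}"
      using 1 3 by auto
  next
    fix x assume x: "x \<in> {x \<in> extensional \<Gamma>. finite {\<gamma> \<in> \<Gamma>. x \<gamma>} \<and> card {\<gamma> \<in> \<Gamma>. x \<gamma>} \<le> n}"
    then have "x = char_fun \<Gamma> {\<gamma> \<in> \<Gamma>. x \<gamma>}"
      using 2 by blast
    moreover have "{\<gamma> \<in> \<Gamma>. x \<gamma>} \<subseteq> \<Gamma>" "finite {\<gamma> \<in> \<Gamma>. x \<gamma>}" "card {\<gamma> \<in> \<Gamma>. x \<gamma>} \<le> n"
      using x by auto
    ultimately show "x \<in> {char_fun \<Gamma> A |A. A \<subseteq> \<Gamma> \<and> finite A \<and> card A \<le> n}"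
      by blast
  qed
  finally show ?thesis .
qed

lemma continuous_map_sigma_coord:
  assumes "\<gamma> \<in> \<Gamma>"
  shows "continuous_map (sigma_space n \<Gamma>) (discrete_topology UNIV) (\<lambda>x. x \<gamma>)"
  unfolding sigma_space_def cube_def
  by (rule continuous_map_from_subtopology)
    (use continuous_map_product_projection[OF assms, of "\<lambda>_. discrete_topology (UNIV :: bool set)"] in simp)

lemma continuous_map_into_sigma:
  assumes "\<And>\<gamma>. \<gamma> \<in> \<Gamma> \<Longrightarrow> continuous_map X (discrete_topology UNIV) (\<lambda>x. f x \<gamma>)"
    and "f \<in> topspace X \<rightarrow> topspace (sigma_space n \<Gamma>)"
  shows "continuous_map X (sigma_space n \<Gamma>) f"
proof -
  have sub: "topspace (sigma_space n \<Gamma>) \<subseteq> extensional \<Gamma>"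
    by (auto simp: topspace_sigma_space)
  have "continuous_map X (cube \<Gamma>) f"
    unfolding cube_def continuous_map_componentwise using assms sub by fastforce
  then show ?thesis
    using assms(2) unfolding sigma_space_def
    by (auto simp: continuous_map_in_subtopology)
qed

lemma EC_classI:
  fixes K :: "'k topology" and \<Gamma> :: "'g set"
  assumes K: "compact_space K" and f: "embedding_map K (sigma_space n \<Gamma>) f"
  shows "EC_class n K"
proof -
  define S where "S = (\<lambda>x. {\<gamma> \<in> \<Gamma>. f x \<gamma>})"
  have hf: "homeomorphic_map K (subtopology (sigma_space n \<Gamma>) (f ` topspace K)) f"
    using f by (simp add: embedding_map_def)
  have cf: "continuous_map K (sigma_space n \<Gamma>) f"
    using hf by (simp add: continuous_map_in_subtopology homeomorphic_eq_everything_map)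
  have fx: "f x \<in> extensional \<Gamma>" "finite (S x)" "card (S x) \<le> n" if "x \<in> topspace K" for x
    using continuous_map_funspace[OF cf] that by (auto simp: topspace_sigma_space S_def)
  define p where "p = (\<lambda>\<gamma>. SOME x. x \<in> topspace K \<and> \<gamma> \<in> S x)"
  define \<Gamma>' where "\<Gamma>' = (\<Union>x\<in>topspace K. S x)"
  have p: "p \<gamma> \<in> topspace K \<and> \<gamma> \<in> S (p \<gamma>)" if "\<gamma> \<in> \<Gamma>'" for \<gamma>
    unfolding p_def by (rule someI_ex) (use that in \<open>auto simp: \<Gamma>'_def\<close>)
  define e where "e = (\<lambda>x. SOME e :: 'g \<Rightarrow> nat. inj_on e (S x))"
  have e: "inj_on (e x) (S x)" if x: "x \<in> topspace K" for x
  proof -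
    have "\<exists>e :: 'g \<Rightarrow> nat. inj_on e (S x)"
      using finite_imp_inj_to_nat_seg[OF fx(2)[OF x]] by blast
    then show ?thesis
      unfolding e_def by (rule someI_ex)
  qed
  define h where "h = (\<lambda>\<gamma>. (p \<gamma>, e (p \<gamma>) \<gamma>))"
  have inj: "inj_on h \<Gamma>'"
    unfolding h_def by (intro inj_onI) (metis e p inj_onD prod.inject)
  define \<Delta> where "\<Delta> = h ` \<Gamma>'"
  have sub: "\<Gamma>' \<subseteq> \<Gamma>"
    by (auto simp: \<Gamma>'_def S_def)
  define k where "k = inv_into \<Gamma>' h"
  have kh: "k (h \<gamma>) = \<gamma>" if "\<gamma> \<in> \<Gamma>'" for \<gamma>
    unfolding k_def using inj that by (rule inv_into_f_f)
  define P where "P = (\<lambda>y. \<lambda>\<delta>\<in>\<Delta>. y (k \<delta>) :: bool)"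
  define Q where "Q = (\<lambda>z. \<lambda>\<gamma>\<in>\<Gamma>. if \<gamma> \<in> \<Gamma>' then z (h \<gamma>) else False)"
  have kD: "k \<delta> \<in> \<Gamma>'" if "\<delta> \<in> \<Delta>" for \<delta>
    using that kh by (auto simp: \<Delta>_def)
  have injk: "inj_on k \<Delta>"
    using kh by (auto simp: \<Delta>_def inj_on_def)
  have P: "continuous_map (sigma_space n \<Gamma>) (sigma_space n \<Delta>) P"
  proof (rule continuous_map_into_sigma)
    fix \<delta> assume d: "\<delta> \<in> \<Delta>"
    then show "continuous_map (sigma_space n \<Gamma>) (discrete_topology UNIV) (\<lambda>y. P y \<delta>)"
      using continuous_map_sigma_coord[of "k \<delta>" \<Gamma> n] kD[OF d] sub by (auto simp: P_def)
  next
    have "finite {\<delta> \<in> \<Delta>. P y \<delta>} \<and> card {\<delta> \<in> \<Delta>. P y \<delta>} \<le> n"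
      if y: "finite {\<gamma> \<in> \<Gamma>. y \<gamma>}" "card {\<gamma> \<in> \<Gamma>. y \<gamma>} \<le> n" for y
    proof -
      have i: "inj_on k {\<delta> \<in> \<Delta>. P y \<delta>}"
        using injk by (rule inj_on_subset) auto
      have s: "k ` {\<delta> \<in> \<Delta>. P y \<delta>} \<subseteq> {\<gamma> \<in> \<Gamma>. y \<gamma>}"
        using kD sub by (auto simp: P_def)
      show ?thesis
        using inj_on_finite[OF i s y(1)] card_inj_on_le[OF i s y(1)] y(2) by simp
    qed
    then show "P \<in> topspace (sigma_space n \<Gamma>) \<rightarrow> topspace (sigma_space n \<Delta>)"
      by (auto simp: topspace_sigma_space P_def)
  qed
  have Q: "continuous_map (sigma_space n \<Delta>) (sigma_space n \<Gamma>) Q"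
  proof (rule continuous_map_into_sigma)
    fix \<gamma> assume "\<gamma> \<in> \<Gamma>"
    then show "continuous_map (sigma_space n \<Delta>) (discrete_topology UNIV) (\<lambda>z. Q z \<gamma>)"
      using continuous_map_sigma_coord[of "h \<gamma>" \<Delta> n] by (cases "\<gamma> \<in> \<Gamma>'") (auto simp: Q_def \<Delta>_def)
  next
    have "finite {\<gamma> \<in> \<Gamma>. Q z \<gamma>} \<and> card {\<gamma> \<in> \<Gamma>. Q z \<gamma>} \<le> n"
      if z: "finite {\<delta> \<in> \<Delta>. z \<delta>}" "card {\<delta> \<in> \<Delta>. z \<delta>} \<le> n" for z
    proof -
      have i: "inj_on h {\<gamma> \<in> \<Gamma>. Q z \<gamma>}"
        using inj by (rule inj_on_subset) (auto simp: Q_def split: if_splits)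
      have s: "h ` {\<gamma> \<in> \<Gamma>. Q z \<gamma>} \<subseteq> {\<delta> \<in> \<Delta>. z \<delta>}"
        by (auto simp: Q_def \<Delta>_def split: if_splits)
      show ?thesis
        using inj_on_finite[OF i s z(1)] card_inj_on_le[OF i s z(1)] z(2) by simp
    qed
    then show "Q \<in> topspace (sigma_space n \<Delta>) \<rightarrow> topspace (sigma_space n \<Gamma>)"
      by (auto simp: topspace_sigma_space Q_def)
  qed
  have QP: "Q (P (f x)) = f x" if x: "x \<in> topspace K" for x
  proof
    fix \<gamma>
    show "Q (P (f x)) \<gamma> = f x \<gamma>"
      using x fx(1)[OF x] kh[of \<gamma>]
      by (auto simp: Q_def P_def \<Delta>_def \<Gamma>'_def S_def extensional_def)
  qed
  obtain g where g: "homeomorphic_maps K (subtopology (sigma_space n \<Gamma>) (f ` topspace K)) f g"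
    using hf by (auto simp: homeomorphic_map_maps)
  have "homeomorphic_maps K (subtopology (sigma_space n \<Delta>) ((P \<circ> f) ` topspace K)) (P \<circ> f) (g \<circ> Q)"
    unfolding homeomorphic_maps_def
  proof (intro conjI ballI)
    show "continuous_map K (subtopology (sigma_space n \<Delta>) ((P \<circ> f) ` topspace K)) (P \<circ> f)"
      using continuous_map_compose[OF cf P] by (auto simp: continuous_map_in_subtopology)
    have "continuous_map (subtopology (sigma_space n \<Delta>) ((P \<circ> f) ` topspace K))
        (subtopology (sigma_space n \<Gamma>) (f ` topspace K)) Q"
      using Q QP by (auto simp: continuous_map_in_subtopology intro: continuous_map_from_subtopology)
    then show "continuous_map (subtopology (sigma_space n \<Delta>) ((P \<circ> f) ` topspace K)) K (g \<circ> Q)"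
      using g continuous_map_compose unfolding homeomorphic_maps_def by blast
    have gf: "g (f x) = x" if "x \<in> topspace K" for x
      using g that by (simp add: homeomorphic_maps_def)
    show "(g \<circ> Q) ((P \<circ> f) x) = x" if "x \<in> topspace K" for x
      using that QP gf by simp
    show "(P \<circ> f) ((g \<circ> Q) y) = y"
      if "y \<in> topspace (subtopology (sigma_space n \<Delta>) ((P \<circ> f) ` topspace K))" for y
      using that QP gf by auto
  qed
  then have "embedding_map K (sigma_space n \<Delta>) (P \<circ> f)"
    unfolding embedding_map_def homeomorphic_map_maps by blast
  then show ?thesis
    using K unfolding EC_class_def by blast
qed

lemma EC_class_homeomorphic_space:
  assumes "K homeomorphic_space L"
  shows "EC_class n K \<longleftrightarrow> EC_class n L"
proof -
  have *: "EC_class n Y" if X: "X homeomorphic_space Y" "EC_class n X"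
    for X :: "'c topology" and Y :: "'d topology"
  proof -
    obtain g where g: "homeomorphic_map Y X g"
      using X(1) homeomorphic_space homeomorphic_space_sym by blast
    obtain \<Gamma> :: "('c \<times> nat) set" and f where f: "embedding_map X (sigma_space n \<Gamma>) f"
      using X(2) by (auto simp: EC_class_def)
    have "embedding_map Y X g"
      using g surjective_embedding_map by blast
    then have "embedding_map Y (sigma_space n \<Gamma>) (f \<circ> g)"
      using f embedding_map_compose by blast
    moreover have "compact_space Y"
      using X homeomorphic_compact_space by (auto simp: EC_class_def)
    ultimately show ?thesis
      using EC_classI by blast
  qed
  show ?thesis
    using *[of K L] *[of L K] assms homeomorphic_space_sym by blast
qed

end

theory Submission
  imports Defs
begin

text \<open>
  Fix a fixed-point-free involution \<open>\<tau>\<close> of an uncountable set \<open>\<Gamma>\<close> and let \<open>K\<close> be the quotient of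
  \<open>\<sigma>\<^sub>2(\<Gamma>)\<close> that glues the points \<open>{\<alpha>}\<close> and \<open>{\<tau> \<alpha>}\<close> and nothing else.  The space \<open>K\<close> is realised as
  the image of \<open>\<sigma>\<^sub>2(\<Gamma>)\<close> in a cube under the map \<open>fold_map\<close>, so that it is Tikhonov for free.

  An embedding of \<open>K\<close> into \<open>\<sigma>\<^sub>2(\<Delta>)\<close> would yield a continuous map \<open>F\<close> from \<open>\<sigma>\<^sub>2(\<Gamma>)\<close> to \<open>\<sigma>\<^sub>2(\<Delta>)\<close>
  that glues exactly these points; write \<open>S A\<close> for the support of the image of \<open>A\<close>.  By continuity
  an element of \<open>S A\<close> stays in \<open>S (insert \<beta> A)\<close> for all but finitely many \<open>\<beta>\<close>
  (\<open>finite_variation\<close>).  Hence a non-isolated point has a support with fewer than two elements, and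
  counting gives \<open>S {} = {}\<close> and \<open>S {\<alpha>} = {s \<alpha>}\<close> with \<open>s \<alpha> = s \<beta>\<close> only for \<open>\<beta> \<in> {\<alpha>, \<tau> \<alpha>}\<close>.
  For \<open>\<alpha>\<close> and \<open>\<beta>\<close> in general position the isolated points \<open>{\<alpha>, \<beta>}\<close> and \<open>{\<tau> \<alpha>, \<beta>}\<close> both get the
  support \<open>{s \<alpha>, s \<beta>}\<close>, although \<open>F\<close> separates them.  General position means that
  each of \<open>\<alpha>\<close> and \<open>\<beta>\<close> avoids a finite set attached to the other; this is where uncountability
  enters (\<open>exists_generic_pair\<close>): on the natural numbers the sets \<open>{0..n}\<close> leave no such pair.
\<close>

section \<open>Uncountable sets\<close>

lemma uncountable_omega_1: "uncountable omega_1"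
proof
  assume "countable omega_1"
  then have "(card_of omega_1, natLeq) \<in> ordLeq"
    using card_of_ordLeq[of omega_1 "UNIV :: nat set"] card_of_nat ordLeq_ordIso_trans
    by (auto simp: countable_def)
  moreover have "(card_of omega_1, cardSuc natLeq) \<in> ordIso"
    unfolding omega_1_def
    by (intro card_of_Field_ordIso cardSuc_Card_order natLeq_Card_order)
  moreover have "(natLeq, cardSuc natLeq) \<in> ordLess"
    by (rule cardSuc_greater[OF natLeq_Card_order])
  ultimately show False
    using not_ordLess_ordLeq ordIso_ordLeq_trans ordIso_symmetric by blast
qed

lemma exists_fixpoint_free_involution:
  assumes "infinite \<Gamma>"
  obtains \<tau> where "\<And>\<gamma>. \<gamma> \<in> \<Gamma> \<Longrightarrow> \<tau> \<gamma> \<in> \<Gamma>" "\<And>\<gamma>. \<gamma> \<in> \<Gamma> \<Longrightarrow> \<tau> (\<tau> \<gamma>) = \<gamma>"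
    "\<And>\<gamma>. \<gamma> \<in> \<Gamma> \<Longrightarrow> \<tau> \<gamma> \<noteq> \<gamma>"
proof -
  have "(card_of (\<Gamma> <+> \<Gamma>), card_of \<Gamma>) \<in> ordIso"
    using card_of_Plus_infinite1[OF assms ordLeq_refl[OF card_of_Card_order]] .
  then obtain b where b: "bij_betw b (\<Gamma> <+> \<Gamma>) \<Gamma>"
    using card_of_ordIso by blast
  define swap :: "'a + 'a \<Rightarrow> 'a + 'a" where "swap = case_sum Inr Inl"
  define c where "c = inv_into (\<Gamma> <+> \<Gamma>) b"
  have c: "c \<gamma> \<in> \<Gamma> <+> \<Gamma>" "b (c \<gamma>) = \<gamma>" if "\<gamma> \<in> \<Gamma>" for \<gamma>
    using that b unfolding c_def
    by (auto simp: bij_betw_def f_inv_into_f inv_into_into)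
  have cb: "c (b s) = s" "b s \<in> \<Gamma>" if "s \<in> \<Gamma> <+> \<Gamma>" for s
    using that b unfolding c_def by (auto simp: bij_betw_def)
  have swap: "swap s \<in> \<Gamma> <+> \<Gamma>" "swap (swap s) = s" "swap s \<noteq> s" if "s \<in> \<Gamma> <+> \<Gamma>" for s
    using that by (auto simp: swap_def)
  show ?thesis
  proof (rule that[of "\<lambda>\<gamma>. b (swap (c \<gamma>))"])
    fix \<gamma> assume g: "\<gamma> \<in> \<Gamma>"
    show "b (swap (c \<gamma>)) \<in> \<Gamma>" "b (swap (c (b (swap (c \<gamma>))))) = \<gamma>"
      using c[OF g] cb swap by auto
    show "b (swap (c \<gamma>)) \<noteq> \<gamma>"
      using c[OF g] cb swap by metis
  qed
qed

text \<open>
  Countably many of the finite sets \<open>E \<alpha>\<close> do not cover \<open>\<Gamma>\<close>, so some \<open>\<beta>\<close> avoids \<open>E \<alpha>\<close> for infinitely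
  many \<open>\<alpha>\<close>; only finitely many of these can lie in \<open>E \<beta>\<close>.
\<close>

lemma exists_generic_pair:
  assumes "uncountable \<Gamma>" and E: "\<And>\<alpha>. \<alpha> \<in> \<Gamma> \<Longrightarrow> finite (E \<alpha>)"
  obtains \<alpha> \<beta> where "\<alpha> \<in> \<Gamma>" "\<beta> \<in> \<Gamma>" "\<beta> \<notin> E \<alpha>" "\<alpha> \<notin> E \<beta>"
proof -
  have "infinite \<Gamma>"
    using assms(1) countable_finite by blast
  then obtain A where A: "countable A" "infinite A" "A \<subseteq> \<Gamma>"
    by (metis infinite_countable_subset')
  have "countable (\<Union>\<alpha>\<in>A. E \<alpha>)"
    using A E by (blast intro: countable_UN countable_finite)
  then obtain \<beta> where b: "\<beta> \<in> \<Gamma>" "\<beta> \<notin> (\<Union>\<alpha>\<in>A. E \<alpha>)"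
    using assms(1) by (meson countable_subset subsetI)
  obtain \<alpha> where "\<alpha> \<in> A" "\<alpha> \<notin> E \<beta>"
    using A(2) E[OF b(1)] by (meson finite_subset subsetI)
  then show ?thesis
    using that A(3) b by blast
qed

section \<open>Continuous maps between the spaces of small subsets\<close>

lemma char_fun_in_sigma:
  assumes "A \<subseteq> \<Gamma>" "finite A" "card A \<le> n"
  shows "char_fun \<Gamma> A \<in> topspace (sigma_space n \<Gamma>)"
proof -
  have "{\<gamma> \<in> \<Gamma>. char_fun \<Gamma> A \<gamma>} = A"
    using assms(1) by (auto simp: char_fun_def)
  then show ?thesis
    using assms by (simp add: topspace_sigma_space) (simp add: char_fun_def)
qed

text \<open>
  The points \<open>insert \<beta> A\<close> converge to \<open>A\<close>: a basic neighbourhood of \<open>A\<close> constrains only finitely many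
  coordinates.
\<close>

lemma finite_variation:
  assumes F: "continuous_map (sigma_space n \<Gamma>) (sigma_space m \<Delta>) F" and d: "d \<in> \<Delta>"
    and A: "A \<subseteq> \<Gamma>" "finite A" "card A < n"
  shows "finite {\<beta> \<in> \<Gamma>. F (char_fun \<Gamma> (insert \<beta> A)) d \<noteq> F (char_fun \<Gamma> A) d}"
proof -
  define V where "V = {x \<in> topspace (sigma_space n \<Gamma>). F x d \<in> {F (char_fun \<Gamma> A) d}}"
  have "continuous_map (sigma_space n \<Gamma>) (discrete_topology UNIV) (\<lambda>x. F x d)"
    using continuous_map_compose[OF F continuous_map_sigma_coord[OF d]] by (simp add: comp_def)
  then have "openin (sigma_space n \<Gamma>) V"
    unfolding V_def by (rule openin_continuous_map_preimage) simp
  then obtain T Z where T: "openin (cube \<Gamma>) T" "V = T \<inter> Z"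
    and Z: "topspace (sigma_space n \<Gamma>) \<subseteq> Z"
    unfolding sigma_space_def openin_subtopology by auto
  have "char_fun \<Gamma> A \<in> V"
    using char_fun_in_sigma[of A \<Gamma> n] A by (simp add: V_def)
  then obtain U where U: "finite {i \<in> \<Gamma>. U i \<noteq> UNIV}" "char_fun \<Gamma> A \<in> Pi\<^sub>E \<Gamma> U" "Pi\<^sub>E \<Gamma> U \<subseteq> T"
    using T unfolding cube_def openin_product_topology_alt by auto
  have "{\<beta> \<in> \<Gamma>. F (char_fun \<Gamma> (insert \<beta> A)) d \<noteq> F (char_fun \<Gamma> A) d} \<subseteq> {i \<in> \<Gamma>. U i \<noteq> UNIV}"
  proof (intro subsetI, rule ccontr)
    fix \<beta> assume b: "\<beta> \<in> {\<beta> \<in> \<Gamma>. F (char_fun \<Gamma> (insert \<beta> A)) d \<noteq> F (char_fun \<Gamma> A) d}"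
      and "\<beta> \<notin> {i \<in> \<Gamma>. U i \<noteq> UNIV}"
    then have "U \<beta> = UNIV"
      by simp
    then have "(i \<in> insert \<beta> A) \<in> U i" if "i \<in> \<Gamma>" for i
      using U(2) that by (cases "i = \<beta>") (auto simp: PiE_iff char_fun_def)
    then have "char_fun \<Gamma> (insert \<beta> A) \<in> Pi\<^sub>E \<Gamma> U"
      by (simp add: PiE_iff char_fun_def)
    moreover have "char_fun \<Gamma> (insert \<beta> A) \<in> topspace (sigma_space n \<Gamma>)"
      using A b by (intro char_fun_in_sigma) (auto simp: card_insert_if)
    ultimately show False
      using b U(3) T(2) Z by (auto simp: V_def)
  qed
  then show ?thesis
    using U(1) by (rule finite_subset)
qed

text \<open>
  The cardinality bound 2 in the target acts through saturation: once two elements are known to lie in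
  a support, that support is determined.  Continuity hands the elements of \<open>S A\<close> down to almost all
  \<open>S (insert \<beta> A)\<close>, so a saturated \<open>S A\<close> would be inherited by points from which \<open>A\<close> is separated.
\<close>

theorem no_map_glueing_only_paired_singletons:
  fixes F :: "('g \<Rightarrow> bool) \<Rightarrow> ('d \<Rightarrow> bool)" and \<Gamma> :: "'g set"
  defines "G \<equiv> \<lambda>A. F (char_fun \<Gamma> A)"
  assumes F: "continuous_map (sigma_space 2 \<Gamma>) (sigma_space 2 \<Delta>) F"
    and unc: "uncountable \<Gamma>"
    and \<tau>: "\<And>\<gamma>. \<gamma> \<in> \<Gamma> \<Longrightarrow> \<tau> \<gamma> \<in> \<Gamma>" "\<And>\<gamma>. \<gamma> \<in> \<Gamma> \<Longrightarrow> \<tau> (\<tau> \<gamma>) = \<gamma>"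
    and glue: "\<And>\<alpha>. \<alpha> \<in> \<Gamma> \<Longrightarrow> G {\<tau> \<alpha>} = G {\<alpha>}"
    and sep0: "\<And>\<alpha>. \<alpha> \<in> \<Gamma> \<Longrightarrow> G {\<alpha>} \<noteq> G {}"
    and sep1: "\<And>\<alpha> \<beta>. \<lbrakk>\<alpha> \<in> \<Gamma>; \<beta> \<in> \<Gamma>; \<beta> \<notin> {\<alpha>, \<tau> \<alpha>}\<rbrakk> \<Longrightarrow> G {\<alpha>} \<noteq> G {\<beta>}"
    and sep2: "\<And>\<alpha> \<beta>. \<lbrakk>\<alpha> \<in> \<Gamma>; \<beta> \<in> \<Gamma>; \<beta> \<noteq> \<alpha>\<rbrakk> \<Longrightarrow> G {\<beta>, \<alpha>} \<noteq> G {\<alpha>}"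
    and sep3: "\<And>\<alpha> \<beta>. \<lbrakk>\<alpha> \<in> \<Gamma>; \<beta> \<in> \<Gamma>; \<beta> \<notin> {\<alpha>, \<tau> \<alpha>}\<rbrakk> \<Longrightarrow> G {\<alpha>, \<beta>} \<noteq> G {\<tau> \<alpha>, \<beta>}"
  shows False
proof -
  define S where "S = (\<lambda>A. {d \<in> \<Delta>. G A d})"
  define E where "E = (\<lambda>A d. {\<beta> \<in> \<Gamma>. G (insert \<beta> A) d \<noteq> G A d})"
  have inf: "infinite \<Gamma>"
    using unc countable_finite by blast
  have im: "G A \<in> extensional \<Delta>" "finite (S A)" "card (S A) \<le> 2"
    if "A \<subseteq> \<Gamma>" "finite A" "card A \<le> 2" for A
    using continuous_map_funspace[OF F] char_fun_in_sigma[OF that]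
    by (auto simp: topspace_sigma_space S_def G_def Pi_iff)
  have eq: "G A = G B"
    if "S A = S B" "A \<subseteq> \<Gamma>" "finite A" "card A \<le> 2" "B \<subseteq> \<Gamma>" "finite B" "card B \<le> 2" for A B
  proof (rule extensionalityI)
    show "G A \<in> extensional \<Delta>" "G B \<in> extensional \<Delta>"
      using im that by blast+
    show "G A d = G B d" if "d \<in> \<Delta>" for d
      using that \<open>S A = S B\<close> by (auto simp: S_def)
  qed
  have finE: "finite (E A d)" if "A \<subseteq> \<Gamma>" "finite A" "card A < 2" "d \<in> \<Delta>" for A d
    using finite_variation[OF F that(4,1-3)] by (simp add: E_def G_def)
  have mono: "d \<in> S (insert \<beta> A)" if "d \<in> S A" "\<beta> \<in> \<Gamma>" "\<beta> \<notin> E A d" for d \<beta> A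
    using that by (auto simp: E_def S_def)
  have small: "card (S {\<alpha>}) \<le> 1" if a: "\<alpha> \<in> \<Gamma>" for \<alpha>
  proof (rule ccontr)
    assume "\<not> card (S {\<alpha>}) \<le> 1"
    then have 2: "card (S {\<alpha>}) = 2"
      using im(3)[of "{\<alpha>}"] a by simp
    have "finite (insert \<alpha> (\<Union>d\<in>S {\<alpha>}. E {\<alpha>} d))"
      using im(2)[of "{\<alpha>}"] finE[of "{\<alpha>}"] a by (auto simp: S_def)
    then obtain \<beta> where "\<beta> \<in> \<Gamma>" "\<beta> \<notin> insert \<alpha> (\<Union>d\<in>S {\<alpha>}. E {\<alpha>} d)"
      using inf by (meson finite_subset subsetI)
    then have b: "\<beta> \<in> \<Gamma>" "\<beta> \<noteq> \<alpha>" "\<And>d. d \<in> S {\<alpha>} \<Longrightarrow> \<beta> \<notin> E {\<alpha>} d"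
      by blast+
    have "S {\<alpha>} \<subseteq> S {\<beta>, \<alpha>}"
      using mono b by blast
    then have "S {\<alpha>} = S {\<beta>, \<alpha>}"
      using im(2,3)[of "{\<beta>, \<alpha>}"] a b 2 by (intro card_seteq) (auto simp: card_insert_if)
    then show False
      using eq[of "{\<alpha>}" "{\<beta>, \<alpha>}"] a b sep2[of \<alpha> \<beta>] by (simp add: card_insert_if)
  qed
  have sing: "S {\<alpha>} = {d}" if "\<alpha> \<in> \<Gamma>" "d \<in> S {\<alpha>}" for \<alpha> d
    using small[of \<alpha>] that im(2)[of "{\<alpha>}"]
    by (auto simp: card_le_Suc0_iff_eq)
  \<comment> \<open>An element of \<open>S {}\<close> would be the whole support of almost all singletons.\<close>
  have empty: "S {} = {}"
  proof (rule ccontr)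
    assume "S {} \<noteq> {}"
    then obtain d where d: "d \<in> S {}" by blast
    have fin: "finite (E {} d)"
      using finE[of "{}" d] d by (simp add: S_def)
    obtain \<alpha> where a: "\<alpha> \<in> \<Gamma>" "\<alpha> \<notin> E {} d"
      using fin inf by (meson finite_subset subsetI)
    obtain \<beta> where b: "\<beta> \<in> \<Gamma>" "\<beta> \<notin> E {} d" "\<beta> \<notin> {\<alpha>, \<tau> \<alpha>}"
      using inf finite_subset[of \<Gamma> "E {} d \<union> {\<alpha>, \<tau> \<alpha>}"] fin by blast
    have "S {\<alpha>} = S {\<beta>}"
      using sing mono[OF d] a b by metis
    then show False
      using eq[of "{\<alpha>}" "{\<beta>}"] a b sep1[of \<alpha> \<beta>] by simp
  qed
  have "\<exists>d. S {\<alpha>} = {d}" if "\<alpha> \<in> \<Gamma>" for \<alpha>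
  proof -
    have "S {\<alpha>} \<noteq> S {}"
      using eq[of "{\<alpha>}" "{}"] that sep0[of \<alpha>] by auto
    then show ?thesis
      using sing that empty by blast
  qed
  then obtain s where s: "\<And>\<alpha>. \<alpha> \<in> \<Gamma> \<Longrightarrow> S {\<alpha>} = {s \<alpha>}"
    by metis
  have s_tau: "s (\<tau> \<alpha>) = s \<alpha>" if "\<alpha> \<in> \<Gamma>" for \<alpha>
    using s[OF that] s[OF \<tau>(1)[OF that]] glue[OF that] by (simp add: S_def)
  have s_neq: "s \<alpha> \<noteq> s \<beta>" if "\<alpha> \<in> \<Gamma>" "\<beta> \<in> \<Gamma>" "\<beta> \<notin> {\<alpha>, \<tau> \<alpha>}" for \<alpha> \<beta>
    using sep1[OF that] eq[of "{\<alpha>}" "{\<beta>}"] s that by auto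
  have sD: "s \<alpha> \<in> \<Delta>" if "\<alpha> \<in> \<Gamma>" for \<alpha>
    using s[OF that] by (auto simp: S_def)
  have pair: "S {\<alpha>, \<beta>} = {s \<alpha>, s \<beta>}"
    if ab: "\<alpha> \<in> \<Gamma>" "\<beta> \<in> \<Gamma>" "\<beta> \<notin> {\<alpha>, \<tau> \<alpha>}" "\<beta> \<notin> E {\<alpha>} (s \<alpha>)" "\<alpha> \<notin> E {\<beta>} (s \<beta>)" for \<alpha> \<beta>
  proof -
    have "{s \<alpha>, s \<beta>} \<subseteq> S {\<alpha>, \<beta>}"
      using mono[of "s \<alpha>" "{\<alpha>}" \<beta>] mono[of "s \<beta>" "{\<beta>}" \<alpha>] s ab by (auto simp: insert_commute)
    then show ?thesis
      using im(2,3)[of "{\<alpha>, \<beta>}"] s_neq[OF ab(1-3)] ab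
      by (intro card_seteq[symmetric]) (auto simp: card_insert_if)
  qed
  \<comment> \<open>Avoiding \<open>B\<close> puts \<open>\<beta>\<close> in general position both to \<open>\<alpha>\<close> and to \<open>\<tau> \<alpha>\<close>.  The \<open>\<tau>\<close>-image serves the
    symmetric condition: \<open>\<alpha> \<notin> \<tau> ` E {\<beta>} (s \<beta>)\<close> says that \<open>\<tau> \<alpha>\<close> avoids the exceptional set of \<open>\<beta>\<close>.\<close>
  define B where "B = (\<lambda>\<alpha>. {\<alpha>, \<tau> \<alpha>} \<union> E {\<alpha>} (s \<alpha>) \<union> E {\<tau> \<alpha>} (s (\<tau> \<alpha>)) \<union> \<tau> ` E {\<alpha>} (s \<alpha>))"
  have "finite (B \<alpha>)" if "\<alpha> \<in> \<Gamma>" for \<alpha>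
    using finE \<tau> sD that by (auto simp: B_def)
  then obtain \<alpha> \<beta> where ab: "\<alpha> \<in> \<Gamma>" "\<beta> \<in> \<Gamma>" "\<beta> \<notin> B \<alpha>" "\<alpha> \<notin> B \<beta>"
    using exists_generic_pair[OF unc] by blast
  have "\<tau> \<alpha> \<notin> E {\<beta>} (s \<beta>)"
    using ab \<tau>(2)[of \<alpha>] by (force simp: B_def)
  then have "S {\<tau> \<alpha>, \<beta>} = {s \<alpha>, s \<beta>}"
    using pair[of "\<tau> \<alpha>" \<beta>] ab \<tau> s_tau by (auto simp: B_def)
  moreover have "S {\<alpha>, \<beta>} = {s \<alpha>, s \<beta>}"
    using pair[of \<alpha> \<beta>] ab by (auto simp: B_def)
  ultimately have "G {\<alpha>, \<beta>} = G {\<tau> \<alpha>, \<beta>}"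
    using eq[of "{\<alpha>, \<beta>}" "{\<tau> \<alpha>, \<beta>}"] ab \<tau> by (auto simp: card_insert_if)
  then show False
    using sep3[of \<alpha> \<beta>] ab by (auto simp: B_def)
qed

section \<open>The quotient\<close>

text \<open>
  The diagonal coordinates identify \<open>{\<gamma>}\<close> with \<open>{\<tau> \<gamma>}\<close> and separate all other singletons; the
  off-diagonal ones isolate the two-element sets.  The pairs of indices are coded by \<open>c\<close> so that the
  index set of the target cube may live in the same type as \<open>\<Gamma>\<close>.
\<close>

definition fold_map :: "('g \<times> 'g \<Rightarrow> 'j) \<Rightarrow> 'g set \<Rightarrow> ('g \<Rightarrow> 'g) \<Rightarrow> ('g \<Rightarrow> bool) \<Rightarrow> ('j \<Rightarrow> bool)"
  where "fold_map c \<Gamma> \<tau> x = (\<lambda>j\<in>c ` (\<Gamma> \<times> \<Gamma>).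
    case inv_into (\<Gamma> \<times> \<Gamma>) c j of (\<gamma>, \<delta>) \<Rightarrow> if \<gamma> = \<delta> then x \<gamma> \<or> x (\<tau> \<gamma>) else x \<gamma> \<and> x \<delta>)"

lemma fold_map_coord:
  assumes "inj_on c (\<Gamma> \<times> \<Gamma>)" "\<gamma> \<in> \<Gamma>" "\<delta> \<in> \<Gamma>"
  shows "fold_map c \<Gamma> \<tau> x (c (\<gamma>, \<delta>)) = (if \<gamma> = \<delta> then x \<gamma> \<or> x (\<tau> \<gamma>) else x \<gamma> \<and> x \<delta>)"
  using assms by (simp add: fold_map_def)

lemma continuous_map_discrete_binary:
  assumes "continuous_map X (discrete_topology UNIV) f" "continuous_map X (discrete_topology UNIV) g"
  shows "continuous_map X (discrete_topology UNIV) (\<lambda>x. h (f x) (g x))"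
proof -
  have "continuous_map X (discrete_topology (UNIV \<times> UNIV)) (\<lambda>x. (f x, g x))"
    using assms by (metis prod_topology_discrete_topology continuous_map_pairedI)
  then have "continuous_map X (discrete_topology UNIV) ((\<lambda>(a, b). h a b) \<circ> (\<lambda>x. (f x, g x)))"
    by (rule continuous_map_compose) simp
  then show ?thesis
    by (simp add: comp_def)
qed

lemma continuous_map_fold_map:
  assumes c: "inj_on c (\<Gamma> \<times> \<Gamma>)" and \<tau>: "\<And>\<gamma>. \<gamma> \<in> \<Gamma> \<Longrightarrow> \<tau> \<gamma> \<in> \<Gamma>"
  shows "continuous_map (sigma_space n \<Gamma>) (cube (c ` (\<Gamma> \<times> \<Gamma>))) (fold_map c \<Gamma> \<tau>)"
  unfolding cube_def continuous_map_componentwise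
proof (intro conjI ballI)
  show "fold_map c \<Gamma> \<tau> ` topspace (sigma_space n \<Gamma>) \<subseteq> extensional (c ` (\<Gamma> \<times> \<Gamma>))"
    by (auto simp: fold_map_def)
  fix j assume "j \<in> c ` (\<Gamma> \<times> \<Gamma>)"
  then obtain \<gamma> \<delta> where j: "j = c (\<gamma>, \<delta>)" "\<gamma> \<in> \<Gamma>" "\<delta> \<in> \<Gamma>"
    by blast
  note coord = continuous_map_sigma_coord[where n = n]
  show "continuous_map (sigma_space n \<Gamma>) (discrete_topology UNIV) (\<lambda>x. fold_map c \<Gamma> \<tau> x j)"
    using continuous_map_discrete_binary[OF coord[OF j(2)] coord[OF \<tau>[OF j(2)]], of "(\<or>)"]
      continuous_map_discrete_binary[OF coord[OF j(2)] coord[OF j(3)], of "(\<and>)"]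
    by (cases "\<gamma> = \<delta>") (simp_all add: j fold_map_coord[OF c])
qed

lemma Tikhonov_space_subspace_cube: "Tikhonov_space (subtopology (cube I) A)"
  unfolding Tikhonov_space_def cube_def
  by (simp add: completely_regular_space_subtopology completely_regular_space_product_topology
      completely_regular_space_discrete_topology Hausdorff_space_subtopology
      Hausdorff_space_product_topology)

theorem fold_map_image_not_EC2:
  fixes c :: "'g \<times> 'g \<Rightarrow> 'j"
  assumes unc: "uncountable \<Gamma>" and c: "inj_on c (\<Gamma> \<times> \<Gamma>)"
    and \<tau>: "\<And>\<gamma>. \<gamma> \<in> \<Gamma> \<Longrightarrow> \<tau> \<gamma> \<in> \<Gamma>" "\<And>\<gamma>. \<gamma> \<in> \<Gamma> \<Longrightarrow> \<tau> (\<tau> \<gamma>) = \<gamma>" "\<And>\<gamma>. \<gamma> \<in> \<Gamma> \<Longrightarrow> \<tau> \<gamma> \<noteq> \<gamma>"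
  shows "\<not> EC_class 2 (subtopology (cube (c ` (\<Gamma> \<times> \<Gamma>)))
    (fold_map c \<Gamma> \<tau> ` topspace (sigma_space 2 \<Gamma>)))" (is "\<not> EC_class 2 ?K")
proof
  let ?f = "fold_map c \<Gamma> \<tau>"
  have f: "continuous_map (sigma_space 2 \<Gamma>) ?K ?f"
    using continuous_map_fold_map[OF c \<tau>(1)] by (auto simp: continuous_map_in_subtopology)
  assume "EC_class 2 ?K"
  then obtain \<Delta> :: "(('j \<Rightarrow> bool) \<times> nat) set" and h where h: "embedding_map ?K (sigma_space 2 \<Delta>) h"
    by (auto simp: EC_class_def)
  have inj: "inj_on h (topspace ?K)" and ch: "continuous_map ?K (sigma_space 2 \<Delta>) h"
    using h by (auto simp: embedding_map_def homeomorphic_eq_everything_map continuous_map_in_subtopology)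
  have sep: "(h \<circ> ?f) (char_fun \<Gamma> A) \<noteq> (h \<circ> ?f) (char_fun \<Gamma> B)"
    if "A \<subseteq> \<Gamma>" "finite A" "card A \<le> 2" "B \<subseteq> \<Gamma>" "finite B" "card B \<le> 2"
      and "\<gamma> \<in> \<Gamma>" "\<delta> \<in> \<Gamma>" "?f (char_fun \<Gamma> A) (c (\<gamma>, \<delta>)) \<noteq> ?f (char_fun \<Gamma> B) (c (\<gamma>, \<delta>))" for A B \<gamma> \<delta>
  proof
    assume "(h \<circ> ?f) (char_fun \<Gamma> A) = (h \<circ> ?f) (char_fun \<Gamma> B)"
    moreover have "?f (char_fun \<Gamma> A) \<in> topspace ?K" "?f (char_fun \<Gamma> B) \<in> topspace ?K"
      using continuous_map_funspace[OF f] char_fun_in_sigma[OF that(1-3)]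
        char_fun_in_sigma[OF that(4-6)] by (blast dest: funcset_mem)+
    ultimately have "?f (char_fun \<Gamma> A) = ?f (char_fun \<Gamma> B)"
      using inj_onD[OF inj] by simp
    then show False
      using that(9) by simp
  qed
  show False
  proof (rule no_map_glueing_only_paired_singletons[OF continuous_map_compose[OF f ch] unc \<tau>(1,2)])
    fix \<alpha> assume a: "\<alpha> \<in> \<Gamma>"
    have "?f (char_fun \<Gamma> {\<tau> \<alpha>}) = ?f (char_fun \<Gamma> {\<alpha>})"
    proof (rule extensionalityI[of _ "c ` (\<Gamma> \<times> \<Gamma>)"])
      show "?f (char_fun \<Gamma> {\<tau> \<alpha>}) j = ?f (char_fun \<Gamma> {\<alpha>}) j" if "j \<in> c ` (\<Gamma> \<times> \<Gamma>)" for j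
        using that \<tau> a by (auto simp: fold_map_coord[OF c] char_fun_def) metis
    qed (simp_all add: fold_map_def)
    then show "(h \<circ> ?f) (char_fun \<Gamma> {\<tau> \<alpha>}) = (h \<circ> ?f) (char_fun \<Gamma> {\<alpha>})"
      by simp
    show "(h \<circ> ?f) (char_fun \<Gamma> {\<alpha>}) \<noteq> (h \<circ> ?f) (char_fun \<Gamma> {})"
      using a \<tau> by (intro sep[of _ _ \<alpha> \<alpha>]) (auto simp: fold_map_coord[OF c] char_fun_def)
    fix \<beta> assume b: "\<beta> \<in> \<Gamma>"
    show "(h \<circ> ?f) (char_fun \<Gamma> {\<alpha>}) \<noteq> (h \<circ> ?f) (char_fun \<Gamma> {\<beta>})" if "\<beta> \<notin> {\<alpha>, \<tau> \<alpha>}"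
      using a b \<tau> that by (intro sep[of _ _ \<alpha> \<alpha>]) (auto simp: fold_map_coord[OF c] char_fun_def)
    show "(h \<circ> ?f) (char_fun \<Gamma> {\<beta>, \<alpha>}) \<noteq> (h \<circ> ?f) (char_fun \<Gamma> {\<alpha>})" if "\<beta> \<noteq> \<alpha>"
      using a b \<tau> that
      by (intro sep[of _ _ \<alpha> \<beta>]) (auto simp: fold_map_coord[OF c] char_fun_def card_insert_if)
    show "(h \<circ> ?f) (char_fun \<Gamma> {\<alpha>, \<beta>}) \<noteq> (h \<circ> ?f) (char_fun \<Gamma> {\<tau> \<alpha>, \<beta>})" if "\<beta> \<notin> {\<alpha>, \<tau> \<alpha>}"
      using a b \<tau>(1)[OF a] \<tau>(3)[OF a] that
      by (intro sep[of _ _ \<alpha> \<beta>]) (auto simp: fold_map_coord[OF c] char_fun_def card_insert_if)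
  qed
qed

lemma inj_even_odd_coding:
  "inj (\<lambda>(A, B). (\<lambda>n::nat. 2 * n) ` A \<union> (\<lambda>n. 2 * n + 1) ` B)"
proof -
  have "(\<lambda>n. 2 * n) -` ((\<lambda>n::nat. 2 * n) ` A \<union> (\<lambda>n. 2 * n + 1) ` B) = A"
    "(\<lambda>n. 2 * n + 1) -` ((\<lambda>n::nat. 2 * n) ` A \<union> (\<lambda>n. 2 * n + 1) ` B) = B" for A B
    by (auto, presburger+)
  then show ?thesis
    by (smt (verit, del_insts) injI case_prod_conv surj_pair)
qed

theorem mainTheorem3:
  shows "\<exists>(K :: (nat set \<Rightarrow> bool) topology) f.
    Tikhonov_space K \<and>
    continuous_map (sigma_space 2 omega_1) K f \<and>
    f ` topspace (sigma_space 2 omega_1) = topspace K \<and>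
    \<not> EC_class 2 K"
proof -
  define c :: "nat set \<times> nat set \<Rightarrow> nat set"
    where "c = (\<lambda>(A, B). (\<lambda>n. 2 * n) ` A \<union> (\<lambda>n. 2 * n + 1) ` B)"
  have c: "inj_on c (omega_1 \<times> omega_1)"
    unfolding c_def using inj_even_odd_coding inj_on_subset by blast
  obtain \<tau> where \<tau>: "\<And>\<gamma>. \<gamma> \<in> omega_1 \<Longrightarrow> \<tau> \<gamma> \<in> omega_1" "\<And>\<gamma>. \<gamma> \<in> omega_1 \<Longrightarrow> \<tau> (\<tau> \<gamma>) = \<gamma>"
    "\<And>\<gamma>. \<gamma> \<in> omega_1 \<Longrightarrow> \<tau> \<gamma> \<noteq> \<gamma>"
    using exists_fixpoint_free_involution uncountable_omega_1 countable_finite by metis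
  define f where "f = fold_map c omega_1 \<tau>"
  define K where "K = subtopology (cube (c ` (omega_1 \<times> omega_1))) (f ` topspace (sigma_space 2 omega_1))"
  have f: "continuous_map (sigma_space 2 omega_1) (cube (c ` (omega_1 \<times> omega_1))) f"
    unfolding f_def using c \<tau>(1) by (rule continuous_map_fold_map)
  then have "continuous_map (sigma_space 2 omega_1) K f"
    by (auto simp: K_def continuous_map_in_subtopology)
  moreover have "f ` topspace (sigma_space 2 omega_1) = topspace K"
    using continuous_map_image_subset_topspace[OF f] by (auto simp: K_def)
  moreover have "\<not> EC_class 2 K"
    unfolding K_def f_def using uncountable_omega_1 c \<tau> by (rule fold_map_image_not_EC2)
  ultimately show ?thesis
    using Tikhonov_space_subspace_cube unfolding K_def by blast
qed

end
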